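(* Consider the following two-player game on a path with $n\ge 1$ edges. Players 1 and 2 alternate turns, Player 1 first; on a turn the player must, if possible, direct one currently undirected edge, subject to the rule that no internal vertex of the path may become a sink or a source (the two end vertices are exempt from this rule). The player who makes the last legal move wins. Then Player 1 has a winning strategy if $n$ is odd, and Player 2 has a winning strategy if $n$ is even.
   Context: A vertex is a sink if all edges incident to it are directed into it, and a source if all edges incident to it are directed out of it. (This is the Game of Cycles played on a path: since a path has no cycles, the winner is the player making the last legal move.) *)

theory Defs
  imports Main
begin

text \<open>
  The path with \<open>n\<close> edges has vertices \<open>0, \<dots>, n\<close>; \<open>0\<close> and \<open>n\<close> are its two end vertices.
\<close>

definition path_edges :: "nat \<Rightarrow> nat set set" where
  "path_edges n = {{i, Suc i} | i. i < n}"

definition internal_vertices :: "nat \<Rightarrow> nat set" where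
  "internal_vertices n = {v. 0 < v \<and> v < n}"

text \<open>
  A position is the set of arcs chosen so far: an edge \<open>{u, v}\<close> is directed from \<open>u\<close> to \<open>v\<close>
  if \<open>(u, v)\<close> is in that set, and undirected if neither \<open>(u, v)\<close> nor \<open>(v, u)\<close> is.
\<close>

type_synonym arc = "nat \<times> nat"

definition sink :: "nat set set \<Rightarrow> arc set \<Rightarrow> nat \<Rightarrow> bool" where
  "sink E D v \<longleftrightarrow> (\<forall>u. {u, v} \<in> E \<longrightarrow> (u, v) \<in> D)"

definition source :: "nat set set \<Rightarrow> arc set \<Rightarrow> nat \<Rightarrow> bool" where
  "source E D v \<longleftrightarrow> (\<forall>u. {u, v} \<in> E \<longrightarrow> (v, u) \<in> D)"

definition legal_move :: "nat \<Rightarrow> arc set \<Rightarrow> arc \<Rightarrow> bool" where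
  "legal_move n D a \<longleftrightarrow>
     {fst a, snd a} \<in> path_edges n \<and>
     (fst a, snd a) \<notin> D \<and> (snd a, fst a) \<notin> D \<and>
     (\<forall>v \<in> internal_vertices n.
        \<not> sink (path_edges n) (insert a D) v \<and> \<not> source (path_edges n) (insert a D) v)"

text \<open>A play is the chronological list of moves made; it may be unfinished.\<close>

definition play :: "nat \<Rightarrow> arc list \<Rightarrow> bool" where
  "play n h \<longleftrightarrow> (\<forall>i < length h. legal_move n (set (take i h)) (h ! i))"

definition finished_play :: "nat \<Rightarrow> arc list \<Rightarrow> bool" where
  "finished_play n h \<longleftrightarrow> play n h \<and> \<not> (\<exists>a. legal_move n (set h) a)"

datatype player = Player1 | Player2

text \<open>The player who makes the move with (zero-based) index \<open>i\<close>.\<close>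

definition mover :: "nat \<Rightarrow> player" where
  "mover i = (if even i then Player1 else Player2)"

text \<open>
  Only meaningful for nonempty plays; when \<open>n \<ge> 1\<close>, a first move is always possible, so
  finished plays are nonempty.
\<close>

definition winner :: "arc list \<Rightarrow> player" where
  "winner h = mover (length h - 1)"

text \<open>
  A strategy may depend on the whole history. It has to give a legal move whenever its owner
  is to move and can move, so it cannot win vacuously by getting stuck on an illegal move.
\<close>

definition strategy :: "nat \<Rightarrow> player \<Rightarrow> (arc list \<Rightarrow> arc) \<Rightarrow> bool" where
  "strategy n p s \<longleftrightarrow>
     (\<forall>h. play n h \<and> mover (length h) = p \<and> (\<exists>a. legal_move n (set h) a)
        \<longrightarrow> legal_move n (set h) (s h))"

definition follows :: "player \<Rightarrow> (arc list \<Rightarrow> arc) \<Rightarrow> arc list \<Rightarrow> bool" where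
  "follows p s h \<longleftrightarrow> (\<forall>i < length h. mover i = p \<longrightarrow> h ! i = s (take i h))"

definition winning_strategy :: "nat \<Rightarrow> player \<Rightarrow> (arc list \<Rightarrow> arc) \<Rightarrow> bool" where
  "winning_strategy n p s \<longleftrightarrow>
     strategy n p s \<and> (\<forall>h. finished_play n h \<and> follows p s h \<longrightarrow> winner h = p)"

end

theory Submission
  imports Defs
begin

text \<open>
  Reflect the path about its centre and reverse the image of every arc, so that an arc pointing
  along the path still points the same way. The winner keeps the position invariant under this
  map, answering each move with its image; for odd \<open>n\<close> Player 1 first directs the middle
  edge, whose arcs are fixed. The reflection exchanges sinks and sources, so the answer is legal
  unless the move and its answer together create a sink or source. They would then have to meet
  at the middle vertex with the same head or the same tail, but there one arc enters and the other
  leaves.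
\<close>

lemma play_append1:
  "play n (h @ [a]) \<longleftrightarrow> play n h \<and> legal_move n (set h) a"
  unfolding play_def by (auto simp: less_Suc_eq nth_append)

lemma follows_append1:
  "follows p s (h @ [a]) \<longleftrightarrow> follows p s h \<and> (mover (length h) = p \<longrightarrow> a = s h)"
  unfolding follows_def by (auto simp: less_Suc_eq nth_append)

lemma mover_Suc: "mover (Suc i) = p \<longleftrightarrow> mover i \<noteq> p"
  by (cases p) (auto simp: mover_def)

text \<open>\<open>P\<close> is restored after each round, and wherever it holds every opposing move
  \<open>a\<close> has the legal answer \<open>r a\<close>; so \<open>p\<close> always has a move
  when it is needed. Player 1 first reaches \<open>P\<close> by opening with
  \<open>b\<close>.\<close>

lemma response_strategy_wins:
  assumes inv_empty: "p = Player2 \<Longrightarrow> P {}"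
    and inv_first_move: "p = Player1 \<Longrightarrow> P {b}"
    and first_move: "legal_move n {} b"
    and response: "\<And>D a. P D \<Longrightarrow> legal_move n D a \<Longrightarrow> legal_move n (insert a D) (r a)"
    and inv_response: "\<And>D a. P D \<Longrightarrow> legal_move n D a \<Longrightarrow> P (insert (r a) (insert a D))"
  shows "\<exists>s. winning_strategy n p s"
proof -
  define c where "c h = (if h = [] then b else r (last h))" for h
  \<comment> \<open>\<open>strategy\<close> asks for a legal move on every history, including those
    that deviate from \<open>s\<close>, where the answer may be illegal; hence the fallback by
    choice.\<close>
  define s where "s h = (if legal_move n (set h) (c h) then c h
    else (SOME a. legal_move n (set h) a))" for h
  have strat: "strategy n p s"
    unfolding strategy_def s_def by (auto intro: someI)
  \<comment> \<open>When \<open>p\<close> is to move, \<open>P\<close> is recorded for the position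
    before the opponent's last move, the form that \<open>response\<close> takes.\<close>
  have invariant: "if mover (length h) = p
      then h = [] \<or> (\<exists>h' a. h = h' @ [a] \<and> P (set h') \<and> legal_move n (set h') a)
      else P (set h)"
    if "play n h" "follows p s h" for h
    using that
  proof (induction h rule: rev_induct)
    case Nil
    then show ?case using inv_empty by (cases p) (auto simp: mover_def)
  next
    case (snoc a h)
    then have IH: "if mover (length h) = p
        then h = [] \<or> (\<exists>h' a. h = h' @ [a] \<and> P (set h') \<and> legal_move n (set h') a)
        else P (set h)" and legal: "legal_move n (set h) a"
      and a: "mover (length h) = p \<Longrightarrow> a = s h"
      by (auto simp: play_append1 follows_append1)
    show ?case
    proof (cases "mover (length h) = p")
      case False
      then show ?thesis using IH legal by (auto simp: mover_Suc)
    next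
      case True
      then consider "h = []" "p = Player1"
        | h' a' where "h = h' @ [a']" "P (set h')" "legal_move n (set h') a'"
        using IH by (auto simp: mover_def)
      then have "P (set (h @ [a]))"
      proof cases
        case 1
        then show ?thesis using a[OF True] first_move inv_first_move by (simp add: s_def c_def)
      next
        case 2
        then show ?thesis
          using a[OF True] response[of "set h'" a'] inv_response[of "set h'" a']
          by (simp add: s_def c_def insert_commute)
      qed
      then show ?thesis using True by (simp add: mover_Suc)
    qed
  qed
  have "winner h = p" if fin: "finished_play n h" and fol: "follows p s h" for h
  proof -
    \<comment> \<open>On the empty play, \<open>length h - 1\<close> would truncate and
      \<open>winner\<close> would name Player 1 by default.\<close>
    have "h \<noteq> []" using fin first_move unfolding finished_play_def by (metis set_empty)
    moreover have "mover (length h) \<noteq> p"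
    proof
      assume "mover (length h) = p"
      then obtain h' a where "h = h' @ [a]" "P (set h')" "legal_move n (set h') a"
        using invariant[of h] fin fol \<open>h \<noteq> []\<close> by (auto simp: finished_play_def)
      then have "legal_move n (set h) (r a)" using response[of "set h'" a] by simp
      then show False using fin unfolding finished_play_def by blast
    qed
    ultimately show ?thesis
      by (metis Suc_pred' length_greater_0_conv mover_Suc winner_def)
  qed
  with strat show ?thesis unfolding winning_strategy_def by blast
qed

lemma edge_iff: "{u, v} \<in> path_edges n \<longleftrightarrow> u \<le> n \<and> v \<le> n \<and> (v = Suc u \<or> u = Suc v)"
  unfolding path_edges_def by (auto simp: doubleton_eq_iff)

text \<open>An internal vertex has exactly the neighbours \<open>v - 1\<close> and
  \<open>Suc v\<close>; the subtraction is genuine since \<open>0 < v\<close>.\<close>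

lemma sink_iff:
  assumes "v \<in> internal_vertices n"
  shows "sink (path_edges n) D v \<longleftrightarrow> (v - 1, v) \<in> D \<and> (Suc v, v) \<in> D"
proof -
  have "u \<le> n \<and> v \<le> n \<and> (v = Suc u \<or> u = Suc v) \<longleftrightarrow> u = v - 1 \<or> u = Suc v" for u
    using assms by (auto simp: internal_vertices_def)
  then show ?thesis unfolding sink_def edge_iff by auto
qed

lemma source_iff:
  assumes "v \<in> internal_vertices n"
  shows "source (path_edges n) D v \<longleftrightarrow> (v, v - 1) \<in> D \<and> (v, Suc v) \<in> D"
proof -
  have "u \<le> n \<and> v \<le> n \<and> (v = Suc u \<or> u = Suc v) \<longleftrightarrow> u = v - 1 \<or> u = Suc v" for u
    using assms by (auto simp: internal_vertices_def)
  then show ?thesis unfolding source_def edge_iff by auto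
qed

lemma legal_move_empty: "legal_move n {} (i, Suc i)" if "i < n"
  using that by (auto simp: legal_move_def edge_iff sink_iff source_iff)

definition mirror :: "nat \<Rightarrow> arc \<Rightarrow> arc" where
  "mirror n a = (n - snd a, n - fst a)"

text \<open>The bound on the vertices makes \<open>mirror n\<close> an involution despite truncated
  subtraction, so the single inclusion already means invariance.\<close>

definition mirror_closed :: "nat \<Rightarrow> arc set \<Rightarrow> bool" where
  "mirror_closed n D \<longleftrightarrow> D \<subseteq> {..n} \<times> {..n} \<and> mirror n ` D \<subseteq> D"

lemma mirror_mirror: "a \<in> {..n} \<times> {..n} \<Longrightarrow> mirror n (mirror n a) = a"
  by (auto simp: mirror_def)

lemma mirror_closed_insert:
  "mirror_closed n D \<Longrightarrow> a \<in> {..n} \<times> {..n} \<Longrightarrow>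
    mirror_closed n (insert (mirror n a) (insert a D))"
  by (auto simp: mirror_closed_def mirror_mirror mirror_def)

text \<open>Mirroring carries \<open>D\<close> with the answer into \<open>D\<close> with the move,
  so restrictions on the latter transfer to the former.\<close>

lemma mem_mirror_insert:
  assumes "mirror_closed n D" "a \<in> {..n} \<times> {..n}" "x \<le> n" "y \<le> n"
    "(x, y) \<in> insert (mirror n a) D"
  shows "(n - y, n - x) \<in> insert a D"
  using assms by (auto simp: mirror_closed_def mirror_def image_subset_iff split_beta)

lemma legal_move_mirror:
  assumes D: "mirror_closed n D" and legal: "legal_move n D a"
    and not_mid: "fst a + snd a \<noteq> n"
  shows "legal_move n (insert a D) (mirror n a)"
proof -
  obtain u v where a: "a = (u, v)" by (cases a)
  have uv: "u \<le> n" "v \<le> n" "v = Suc u \<or> u = Suc v" "(u, v) \<notin> D" "(v, u) \<notin> D"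
    using legal by (auto simp: a legal_move_def edge_iff)
  have ok: "\<not> ((x - 1, x) \<in> insert a D \<and> (Suc x, x) \<in> insert a D)"
      "\<not> ((x, x - 1) \<in> insert a D \<and> (x, Suc x) \<in> insert a D)"
    if "x \<in> internal_vertices n" for x
    using legal that by (auto simp: legal_move_def sink_iff source_iff)
  have a_le: "a \<in> {..n} \<times> {..n}" using uv by (simp add: a)
  note mem = mem_mirror_insert[OF D a_le]
  \<comment> \<open>A sink at \<open>x\<close> formed by the answer and \<open>D\<close> would
    reflect to a source at \<open>n - x\<close> formed by \<open>a\<close> and \<open>D\<close>, and
    vice versa.\<close>
  have ok': "\<not> ((x - 1, x) \<in> insert (mirror n a) D \<and> (Suc x, x) \<in> insert (mirror n a) D)"
      "\<not> ((x, x - 1) \<in> insert (mirror n a) D \<and> (x, Suc x) \<in> insert (mirror n a) D)"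
    if x: "x \<in> internal_vertices n" for x
  proof -
    have x': "n - x \<in> internal_vertices n" "n - x - 1 = n - Suc x" "Suc (n - x) = n - (x - 1)"
      and le: "x - 1 \<le> n" "x \<le> n" "Suc x \<le> n"
      using x by (auto simp: internal_vertices_def)
    show "\<not> ((x - 1, x) \<in> insert (mirror n a) D \<and> (Suc x, x) \<in> insert (mirror n a) D)"
      using ok(2)[OF x'(1)] mem[OF le(1,2)] mem[OF le(3,2)] unfolding x' by blast
    show "\<not> ((x, x - 1) \<in> insert (mirror n a) D \<and> (x, Suc x) \<in> insert (mirror n a) D)"
      using ok(1)[OF x'(1)] mem[OF le(2,1)] mem[OF le(2,3)] unfolding x' by blast
  qed
  have mem_D: "(n - y, n - x) \<in> D" if "(x, y) \<in> D" for x y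
    using D that by (auto simp: mirror_closed_def mirror_def image_subset_iff split_beta)
  \<comment> \<open>The remaining danger is \<open>a\<close> paired with its own image: a sink needs
    equal heads, a source equal tails, and either forces \<open>fst a + snd a = n\<close>.\<close>
  have ends_ne: "fst (mirror n a) \<noteq> fst a" "snd (mirror n a) \<noteq> snd a"
    using uv(1,2) not_mid by (auto simp: a mirror_def)
  have "(n - v, n - u) \<notin> insert a D" "(n - u, n - v) \<notin> insert a D"
    using mem_D[of "n - v" "n - u"] mem_D[of "n - u" "n - v"] uv not_mid by (auto simp: a)
  moreover have "{n - v, n - u} \<in> path_edges n"
    using uv by (auto simp: edge_iff)
  moreover have "\<not> ((x - 1, x) \<in> insert (mirror n a) (insert a D) \<and>
        (Suc x, x) \<in> insert (mirror n a) (insert a D))"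
      "\<not> ((x, x - 1) \<in> insert (mirror n a) (insert a D) \<and>
        (x, Suc x) \<in> insert (mirror n a) (insert a D))"
    if x: "x \<in> internal_vertices n" for x
    using ok[OF x] ok'[OF x] ends_ne by (metis fst_conv insert_iff snd_conv)+
  ultimately show ?thesis
    by (simp add: legal_move_def sink_iff source_iff mirror_def a)
qed

theorem theorem1:
  fixes n :: nat
  assumes "n \<ge> 1"
  shows "(odd n \<longrightarrow> (\<exists>s. winning_strategy n Player1 s)) \<and>
         (even n \<longrightarrow> (\<exists>s. winning_strategy n Player2 s))"
proof (intro conjI impI)
  have arc_le: "a \<in> {..n} \<times> {..n}" if "legal_move n D a" for D a
    using that by (cases a) (auto simp: legal_move_def edge_iff)
  {
    assume "odd n"
    then obtain m where m: "n = Suc (2 * m)" by (auto elim: oddE)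
    show "\<exists>s. winning_strategy n Player1 s"
    proof (rule response_strategy_wins[where P = "\<lambda>D. mirror_closed n D \<and> (m, Suc m) \<in> D"])
      show "legal_move n {} (m, Suc m)"
        by (rule legal_move_empty) (simp add: m)
      show "mirror_closed n {(m, Suc m)} \<and> (m, Suc m) \<in> {(m, Suc m)}"
        by (simp add: m mirror_closed_def mirror_def)
      fix D a
      assume inv: "mirror_closed n D \<and> (m, Suc m) \<in> D" and legal: "legal_move n D a"
      \<comment> \<open>Only the middle edge has endpoints summing to \<open>n\<close>, and the
        opening move has directed it.\<close>
      have "fst a + snd a \<noteq> n"
      proof
        assume "fst a + snd a = n"
        moreover have "snd a = Suc (fst a) \<or> fst a = Suc (snd a)"
          using legal by (simp add: legal_move_def edge_iff)
        ultimately have "a = (m, Suc m) \<or> a = (Suc m, m)"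
          by (cases a) (auto simp: m)
        then show False using inv legal by (auto simp: legal_move_def)
      qed
      then show "legal_move n (insert a D) (mirror n a)"
        using inv legal legal_move_mirror by blast
      show "mirror_closed n (insert (mirror n a) (insert a D)) \<and>
          (m, Suc m) \<in> insert (mirror n a) (insert a D)"
        using inv mirror_closed_insert arc_le[OF legal] by blast
    qed simp
  next
    assume "even n"
    show "\<exists>s. winning_strategy n Player2 s"
    proof (rule response_strategy_wins[where P = "mirror_closed n"])
      \<comment> \<open>This arc witnesses that the game does not end before its first move.\<close>
      show "legal_move n {} (0, Suc 0)"
        by (rule legal_move_empty) (use assms in simp)
      show "mirror_closed n {}" by (simp add: mirror_closed_def)
      fix D a
      assume inv: "mirror_closed n D" and legal: "legal_move n D a"
      \<comment> \<open>The endpoints of an edge are consecutive, so their sum is odd and the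
        reflection fixes no edge.\<close>
      have "snd a = Suc (fst a) \<or> fst a = Suc (snd a)"
        using legal by (simp add: legal_move_def edge_iff)
      then have "fst a + snd a \<noteq> n" using \<open>even n\<close> by auto
      then show "legal_move n (insert a D) (mirror n a)"
        using inv legal legal_move_mirror by blast
      show "mirror_closed n (insert (mirror n a) (insert a D))"
        using inv mirror_closed_insert arc_le[OF legal] by blast
    qed simp
  }
qed

end
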